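(* Let $m=2n+1$ be a positive odd integer and let $\Theta=(\theta_{p,q})_{1\leq p,q\leq n}$ be a real skew-symmetric matrix. If $\mathcal{P}\in P(C_{\mathrm{alg}}(\mathbb{R}_{\Theta}^{2n+1}))$, then $\mathcal{P}\in P(\mathbb{C})$; that is, every projector of $C_{\mathrm{alg}}(\mathbb{R}_{\Theta}^{2n+1})$ has all its entries in $\mathbb{C}$.
   Context: Put $\lambda_{p,q}:=e^{i\theta_{p,q}}$ with $\theta_{p,q}=-\theta_{q,p}\in\mathbb{R}$. $C_{\mathrm{alg}}(\mathbb{R}_{\Theta}^{2n})$ is the complex unital associative $*$-algebra generated by $2n$ elements $z_p,\bar z_q$ ($p,q=1,\ldots,n$) with relations $$z_pz_q=\lambda_{p,q}z_qz_p,\quad \bar z_p\bar z_q=\lambda_{p,q}\bar z_q\bar z_p,\quad \bar z_pz_q=\lambda_{q,p}z_q\bar z_p,\quad z_p^*=\bar z_p\qquad (p,q=1,\ldots,n).$$ $C_{\mathrm{alg}}(\mathbb{R}_{\Theta}^{2n+1})$ is the unital complex $*$-algebra obtained by adding to $C_{\mathrm{alg}}(\mathbb{R}_{\Theta}^{2n})$ a hermitian generator $x$ ($x^*=x$) with relations $xz_p=z_px$ ($p=1,\ldots,n$); hence $x$ is central. For a unital $*$-algebra $A$, a projector of $A$ is a square matrix $p$ (of any size) with entries in $A$ such that $p^2=p=p^*$, where $(p^* )_{k,l}=(p_{l,k})^*$; $P(A)$ denotes the set of projectors of $A$. $\mathbb{C}$ is regarded as the subalgebra $\mathbb{C}\cdot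 1$ of $C_{\mathrm{alg}}(\mathbb{R}_{\Theta}^{2n+1})$, so that $P(\mathbb{C})\subseteq P(C_{\mathrm{alg}}(\mathbb{R}_{\Theta}^{2n+1}))$. *)

theory Defs
  imports
    Complex_Main
    "HOL-Library.Poly_Mapping"
    "HOL-Algebra.QuotRing"
    "HOL-Algebra.Module"
    "Jordan_Normal_Form.Matrix"
begin

text \<open>Lists under concatenation are the free monoid, so that the convolution product of
  \<^theory>\<open>HOL-Library.Poly_Mapping\<close> makes \<open>'a list \<Rightarrow>\<^sub>0 complex\<close>
  the free unital associative complex algebra on \<open>'a\<close>.\<close>

instantiation list :: (type) monoid_add
begin
definition zero_list :: "'a list" where "zero_list = []"
definition plus_list :: "'a list \<Rightarrow> 'a list \<Rightarrow> 'a list" where "plus_list = (@)"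
instance by standard (simp_all add: zero_list_def plus_list_def)
end


section \<open>Complex *-algebras and their quotients\<close>

record 'a star_algebra = "(complex, 'a) module" +
  star :: "'a \<Rightarrow> 'a"

text \<open>The two-sided *-ideal generated by \<open>S\<close>. Since the algebra is unital, a two-sided ring
  ideal is closed under multiplication by scalars.\<close>

definition star_ideal :: "'a star_algebra \<Rightarrow> 'a set \<Rightarrow> 'a set" where
  "star_ideal A S = Idl\<^bsub>A\<^esub> (S \<union> star A ` S)"

text \<open>The operations on cosets have the shape of \<^const>\<open>rcoset_mult\<close>:
  \<open>c (I + x) = I + c x\<close> and \<open>(I + x)* = I + x*\<close>.\<close>

definition star_quot :: "'a star_algebra \<Rightarrow> 'a set \<Rightarrow> 'a set star_algebra" where
  "star_quot A I =
    \<lparr> carrier = carrier (A Quot I),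
      monoid.mult = monoid.mult (A Quot I),
      one = monoid.one (A Quot I),
      zero = ring.zero (A Quot I),
      add = ring.add (A Quot I),
      smult = (\<lambda>c C. \<Union>x\<in>C. I +>\<^bsub>A\<^esub> (c \<odot>\<^bsub>A\<^esub> x)),
      star = (\<lambda>C. \<Union>x\<in>C. I +>\<^bsub>A\<^esub> star A x) \<rparr>"

text \<open>The *-subalgebra \<open>\<complex> \<cdot> 1\<close>.\<close>

definition scalar_subalgebra :: "'a star_algebra \<Rightarrow> 'a star_algebra" where
  "scalar_subalgebra A = A \<lparr> carrier := {c \<odot>\<^bsub>A\<^esub> \<one>\<^bsub>A\<^esub> | c. True} \<rparr>"


section \<open>Projectors\<close>

definition star_mat_mult :: "'a star_algebra \<Rightarrow> 'a mat \<Rightarrow> 'a mat \<Rightarrow> 'a mat" where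
  "star_mat_mult A P Q = mat (dim_row P) (dim_col Q)
     (\<lambda>(k, l). \<Oplus>\<^bsub>A\<^esub> j \<in> {..<dim_col P}. P $$ (k, j) \<otimes>\<^bsub>A\<^esub> Q $$ (j, l))"

definition star_mat_adjoint :: "'a star_algebra \<Rightarrow> 'a mat \<Rightarrow> 'a mat" where
  "star_mat_adjoint A P = mat (dim_col P) (dim_row P) (\<lambda>(k, l). star A (P $$ (l, k)))"

definition projectors :: "'a star_algebra \<Rightarrow> 'a mat set" where
  "projectors A = {P. square_mat P \<and> elements_mat P \<subseteq> carrier A \<and>
     star_mat_mult A P P = P \<and> star_mat_adjoint A P = P}"


section \<open>The algebra \<open>C\<^sub>a\<^sub>l\<^sub>g(\<real>\<^sub>\<Theta>\<^sup>2\<^sup>n\<^sup>+\<^sup>1)\<close>\<close>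

datatype gen = Z nat | Zbar nat | X

type_synonym ncpoly = "gen list \<Rightarrow>\<^sub>0 complex"

definition gens :: "nat \<Rightarrow> gen set" where
  "gens n = Z ` {..<n} \<union> Zbar ` {..<n} \<union> {X}"

fun gen_star :: "gen \<Rightarrow> gen" where
  "gen_star (Z p) = Zbar p"
| "gen_star (Zbar p) = Z p"
| "gen_star X = X"

text \<open>The conjugate-linear, product-reversing extension of \<^const>\<open>gen_star\<close>; this is how
  \<open>z\<^sub>p* = zbar\<^sub>p\<close> and \<open>x* = x\<close> enter.\<close>

definition nc_star :: "ncpoly \<Rightarrow> ncpoly" where
  "nc_star f = (\<Sum>w \<in> Poly_Mapping.keys f.
     Poly_Mapping.single (rev (map gen_star w)) (cnj (Poly_Mapping.lookup f w)))"

definition nc_const :: "complex \<Rightarrow> ncpoly" where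
  "nc_const c = Poly_Mapping.single [] c"

definition nc_gen :: "gen \<Rightarrow> ncpoly" where
  "nc_gen g = Poly_Mapping.single [g] 1"

definition free_star_algebra :: "nat \<Rightarrow> ncpoly star_algebra" where
  "free_star_algebra n =
    \<lparr> carrier = {f. \<forall>w \<in> Poly_Mapping.keys f. set w \<subseteq> gens n},
      monoid.mult = (*), one = 1, zero = 0, add = (+),
      smult = (\<lambda>c f. nc_const c * f),
      star = nc_star \<rparr>"

definition lam :: "real mat \<Rightarrow> nat \<Rightarrow> nat \<Rightarrow> complex" where
  "lam \<Theta> p q = exp (\<i> * complex_of_real (\<Theta> $$ (p, q)))"

text \<open>Each relation \<open>a = b\<close> is represented by the element \<open>a - b\<close>. Indices run over
  \<open>{..<n}\<close> instead of \<open>{1..n}\<close>.\<close>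

definition theta_relations :: "nat \<Rightarrow> real mat \<Rightarrow> ncpoly set" where
  "theta_relations n \<Theta> =
     {nc_gen (Z p) * nc_gen (Z q) - nc_const (lam \<Theta> p q) * (nc_gen (Z q) * nc_gen (Z p))
        | p q. p < n \<and> q < n} \<union>
     {nc_gen (Zbar p) * nc_gen (Zbar q) - nc_const (lam \<Theta> p q) * (nc_gen (Zbar q) * nc_gen (Zbar p))
        | p q. p < n \<and> q < n} \<union>
     {nc_gen (Zbar p) * nc_gen (Z q) - nc_const (lam \<Theta> q p) * (nc_gen (Z q) * nc_gen (Zbar p))
        | p q. p < n \<and> q < n} \<union>
     {nc_gen X * nc_gen (Z p) - nc_gen (Z p) * nc_gen X | p. p < n}"

definition C_alg_odd :: "nat \<Rightarrow> real mat \<Rightarrow> ncpoly set star_algebra" where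
  "C_alg_odd n \<Theta> =
     star_quot (free_star_algebra n) (star_ideal (free_star_algebra n) (theta_relations n \<Theta>))"

text \<open>\<^const>\<open>genideal\<close> is an intersection over the ideals containing a set, which is meaningful
  because of the following two facts.\<close>

lemma ring_free_star_algebra: "ring (free_star_algebra n)"
proof -
  have k_uminus: "Poly_Mapping.keys (- f) = Poly_Mapping.keys f" for f :: ncpoly
    by transfer simp
  have k_add: "set w \<subseteq> gens n"
    if "\<forall>w \<in> Poly_Mapping.keys f. set w \<subseteq> gens n" "\<forall>w \<in> Poly_Mapping.keys g. set w \<subseteq> gens n"
      "w \<in> Poly_Mapping.keys (f + g)" for f g :: ncpoly and w
    using that Poly_Mapping.keys_add[of f g] by blast
  have k_mult: "set w \<subseteq> gens n"
    if m: "\<forall>w \<in> Poly_Mapping.keys f. set w \<subseteq> gens n" "\<forall>w \<in> Poly_Mapping.keys g. set w \<subseteq> gens n"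
      "w \<in> Poly_Mapping.keys (f * g)" for f g :: ncpoly and w
  proof -
    obtain u v where uv: "w = u + v" "u \<in> Poly_Mapping.keys f" "v \<in> Poly_Mapping.keys g"
      using m(3) Poly_Mapping.keys_mult[of f g] by blast
    have "set w = set u \<union> set v"
      by (simp add: uv(1) plus_list_def)
    thus ?thesis using m(1,2) uv(2,3) by blast
  qed
  show ?thesis
  proof (rule ringI)
    show "abelian_group (free_star_algebra n)"
    proof (rule abelian_groupI)
      fix f assume f: "f \<in> carrier (free_star_algebra n)"
      show "\<exists>g\<in>carrier (free_star_algebra n).
          g \<oplus>\<^bsub>free_star_algebra n\<^esub> f = \<zero>\<^bsub>free_star_algebra n\<^esub>"
        by (rule bexI[of _ "- f"]) (use f in \<open>simp_all add: free_star_algebra_def k_uminus\<close>)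
    qed (auto simp: free_star_algebra_def add.assoc add.commute dest: k_add)
    show "Group.monoid (free_star_algebra n)"
    proof (rule monoidI)
      fix f g assume "f \<in> carrier (free_star_algebra n)" "g \<in> carrier (free_star_algebra n)"
      then show "f \<otimes>\<^bsub>free_star_algebra n\<^esub> g \<in> carrier (free_star_algebra n)"
        using k_mult[of f g] by (simp add: free_star_algebra_def)
    qed (simp_all add: free_star_algebra_def mult.assoc zero_list_def)
  qed (auto simp: free_star_algebra_def distrib_left distrib_right)
qed

lemma theta_relations_subset: "theta_relations n \<Theta> \<subseteq> carrier (free_star_algebra n)"
proof -
  interpret R: ring "free_star_algebra n" by (rule ring_free_star_algebra)
  have gen: "nc_gen g \<in> carrier (free_star_algebra n)" if "g \<in> gens n" for g
    using that by (simp add: free_star_algebra_def nc_gen_def)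
  have const: "nc_const c \<in> carrier (free_star_algebra n)" for c
    by (simp add: free_star_algebra_def nc_const_def)
  have mult: "f * g \<in> carrier (free_star_algebra n)"
    if "f \<in> carrier (free_star_algebra n)" "g \<in> carrier (free_star_algebra n)" for f g
    using R.m_closed[OF that] by (simp add: free_star_algebra_def)
  have diff: "f - g \<in> carrier (free_star_algebra n)"
    if "f \<in> carrier (free_star_algebra n)" "g \<in> carrier (free_star_algebra n)" for f g
    using that Poly_Mapping.keys_diff[of f g] by (fastforce simp: free_star_algebra_def)
  have g: "X \<in> gens n" "p < n \<Longrightarrow> Z p \<in> gens n" "p < n \<Longrightarrow> Zbar p \<in> gens n" for p
    by (simp_all add: gens_def)
  show ?thesis
    unfolding theta_relations_def by (auto intro!: diff mult gen const g)
qed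

end

theory Submission
  imports Defs "HOL-Library.Multiset" "HOL-Algebra.Subrings"
begin

text \<open>Write \<open>M\<close> for a multiset of generators and \<open>M*\<close> for its image under the involution. Every element of the
  algebra is a unique combination of monomials indexed by such multisets, so it behaves like a
  polynomial up to phases. For a projector, \<open>P = P* = P\<^sup>2\<close> gives
  \<open>P\<^sub>k\<^sub>k = \<Sum>j. P\<^sub>k\<^sub>j P\<^sub>k\<^sub>j*\<close>. If some entry in row \<open>k\<close> were not constant, the sum on the right would contain
  a monomial of twice the maximal degree with a positive coefficient, while the left-hand side contains
  no monomial of that degree.

  The top coefficient cannot cancel when the maximum is taken in the right sense. A cancellation such
  as \<open>(z + zbar) (z + zbar)* + (z - zbar) (z - zbar)* = 4 z zbar\<close>, in which \<open>z\<^sup>2\<close> disappears, shows that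
  one should look only at monomials of the form \<open>m m*\<close>, here \<open>z zbar\<close>. So let \<open>M\<close> maximise the Euclidean
  norm of the multiplicity vector of \<open>M + M*\<close>, and read off the coefficient at \<open>M + M*\<close>. By strict
  convexity of the norm only products \<open>N N*\<close> contribute to it
  (\<open>sqnorm_strict_convex\<close>), each with coefficient \<open>\<bar>c\<bar>\<^sup>2\<close>, where \<open>c\<close> is the coefficient of an entry at \<open>N\<close>.
  This is \<open>positive_row_is_constant\<close>.

  The unique expansion is needed in two halves. The functionals \<open>coef \<theta> M\<close> on the free algebra add up the
  coefficients of all words with letters \<open>M\<close>, each corrected by the phase that Weyl-orders the word; they
  vanish on the ideal of relations (\<open>ideal_subset_coef_kernel\<close>) and so are defined on the quotient.
  Conversely, an element for which only the functional at the empty multiset is nonzero is a scalar modulo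
  the ideal (\<open>constant_mod_ideal\<close>), since words with the same letters agree up to their phases
  (\<open>weyl_word_cong\<close>). With Weyl-ordered phases the product is a twisted convolution
  (\<open>coef_mult\<close>), the involution is complex conjugation (\<open>coef_star\<close>), and the twist between \<open>N\<close> and \<open>N*\<close> is
  1 (\<open>twist_star_self\<close>), which is why no phase spoils positivity.\<close>

section \<open>Positivity of leading coefficients\<close>

definition sqnorm :: "'a multiset \<Rightarrow> nat" where
  "sqnorm M = (\<Sum>g\<in>set_mset M. (count M g)\<^sup>2)"

lemma sqnorm_superset:
  assumes "finite U" "set_mset M \<subseteq> U"
  shows "sqnorm M = (\<Sum>g\<in>U. (count M g)\<^sup>2)"
  unfolding sqnorm_def using assms
  by (intro sum.mono_neutral_left) (auto simp: not_in_iff)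

lemma sqnorm_double: "sqnorm (M + M) = 4 * sqnorm M"
  by (simp add: sqnorm_def sum_distrib_left power_mult_distrib flip: mult_2)

lemma sqnorm_eq_0_iff: "sqnorm M = 0 \<longleftrightarrow> M = {#}"
  by (auto simp: sqnorm_def count_eq_zero_iff simp flip: set_mset_eq_empty_iff)

text \<open>The parallelogram law turns the hypotheses into \<open>\<Sum>g. (M g - N g)\<^sup>2 \<le> 0\<close>. A multiset of
  maximal norm is thus the midpoint of two others of at most that norm in the trivial way only,
  which makes it isolate a leading coefficient without any choice of monomial order.\<close>

lemma sqnorm_strict_convex:
  assumes eq: "M + N = K + K" and "sqnorm M \<le> sqnorm K" "sqnorm N \<le> sqnorm K"
  shows "M = K"
proof -
  define U where "U = set_mset (M + N + K)"
  have sq: "int (sqnorm L) = (\<Sum>g\<in>U. (int (count L g))\<^sup>2)" if "L \<in> {M, N, K}" for L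
    using that by (subst sqnorm_superset[of U]) (auto simp: U_def)
  have "(\<Sum>g\<in>U. (int (count M g) - int (count N g))\<^sup>2) =
      (\<Sum>g\<in>U. 2 * (int (count M g))\<^sup>2 + 2 * (int (count N g))\<^sup>2 - 4 * (int (count K g))\<^sup>2)"
  proof (rule sum.cong[OF refl])
    fix g
    have "int (count M g) + int (count N g) = 2 * int (count K g)"
      using arg_cong[OF eq, of "\<lambda>L. count L g"] by simp
    then have n: "int (count N g) = 2 * int (count K g) - int (count M g)" by simp
    show "(int (count M g) - int (count N g))\<^sup>2 =
      2 * (int (count M g))\<^sup>2 + 2 * (int (count N g))\<^sup>2 - 4 * (int (count K g))\<^sup>2"
      unfolding n by (simp add: power2_eq_square algebra_simps)
  qed
  also have "\<dots> = 2 * int (sqnorm M) + 2 * int (sqnorm N) - 4 * int (sqnorm K)"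
    by (simp add: sq sum.distrib sum_subtractf sum_distrib_left)
  also have "\<dots> \<le> 0" using assms(2,3) by simp
  finally have "(\<Sum>g\<in>U. (int (count M g) - int (count N g))\<^sup>2) = 0"
    by (intro antisym sum_nonneg) auto
  then have "\<forall>g\<in>U. count M g = count N g"
    by (subst (asm) sum_nonneg_eq_0_iff) (auto simp: U_def)
  moreover have "\<forall>g. g \<notin> U \<longrightarrow> count M g = count N g"
    by (auto simp: U_def not_in_iff)
  ultimately have "M = N" by (intro multiset_eqI) blast
  show ?thesis
  proof (rule multiset_eqI)
    fix g show "count M g = count K g"
      using arg_cong[OF eq, of "\<lambda>L. count L g"] \<open>M = N\<close> by simp
  qed
qed

abbreviation mset_star :: "gen multiset \<Rightarrow> gen multiset" where
  "mset_star \<equiv> image_mset gen_star"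

lemma gen_star_involution [simp]: "gen_star (gen_star g) = g"
  by (cases g) auto

lemma gen_star_comp [simp]: "gen_star \<circ> gen_star = id"
  by auto

lemma mset_star_involution [simp]: "mset_star (mset_star M) = M"
  by (simp add: multiset.map_comp)

lemma gen_star_in_gens_iff [simp]: "gen_star g \<in> gens n \<longleftrightarrow> g \<in> gens n"
  by (cases g) (auto simp: gens_def)

lemma finite_submultisets: "finite {N. N \<subseteq># M}"
proof (rule finite_subset)
  show "{N. N \<subseteq># M} \<subseteq> mset ` {w. set w \<subseteq> set_mset M \<and> length w \<le> size M}"
  proof (clarify)
    fix N assume "N \<subseteq># M"
    obtain w where "mset w = N" using ex_mset by blast
    with \<open>N \<subseteq># M\<close> show "N \<in> mset ` {w. set w \<subseteq> set_mset M \<and> length w \<le> size M}"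
      by (intro image_eqI[of _ _ w]) (auto dest: mset_subset_eqD size_mset_mono)
  qed
qed (simp add: finite_lists_length_le)

text \<open>The positivity argument. Think of \<open>a j M\<close> as the coefficient at the monomial \<open>M\<close> of the entry
  \<open>j\<close> in row \<open>k\<close> of a projector; the hypothesis \<open>eq\<close> is the diagonal entry of \<open>P = P P*\<close>. Measure
  \<open>M\<close> by the norm of \<open>D M = M + M*\<close>, take \<open>E\<close> of maximal norm among all monomials in the row, and
  compare coefficients at \<open>D E\<close>. Only pairs \<open>(N, N*)\<close> contribute on the right, each with
  \<open>\<bar>a j N\<bar>\<^sup>2\<close>, and \<open>(E, E*)\<close> is among them, so the right-hand side is positive. But \<open>D (D E) = 2 D E\<close> has
  larger norm than \<open>D E\<close> unless \<open>E\<close> is empty, so the left-hand side vanishes.\<close>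

lemma positive_row_is_constant:
  fixes a :: "'j \<Rightarrow> gen multiset \<Rightarrow> complex" and tw :: "gen multiset \<Rightarrow> gen multiset \<Rightarrow> complex"
  assumes fin: "finite J" "\<And>j. j \<in> J \<Longrightarrow> finite {M. a j M \<noteq> 0}"
    and k: "k \<in> J"
    and tw: "\<And>M. tw M (mset_star M) = 1"
    and eq: "\<And>M. a k M = (\<Sum>j\<in>J. \<Sum>N | N \<subseteq># M. tw N (M - N) * a j N * cnj (a j (mset_star (M - N))))"
    and j: "j \<in> J" and ne: "M \<noteq> {#}"
  shows "a j M = 0"
proof (rule ccontr)
  assume "a j M \<noteq> 0"
  define S where "S = (\<Union>j\<in>J. {M. a j M \<noteq> 0})"
  define D where "D = (\<lambda>M. M + mset_star M)"
  have "finite S" "M \<in> S" using fin j \<open>a j M \<noteq> 0\<close> by (auto simp: S_def)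
  have D_star: "D (mset_star N) = D N" for N by (simp add: D_def)
  have "Max ((\<lambda>N. sqnorm (D N)) ` S) \<in> (\<lambda>N. sqnorm (D N)) ` S"
    using \<open>finite S\<close> \<open>M \<in> S\<close> by (intro Max_in) auto
  then obtain E where "E \<in> S" "sqnorm (D E) = Max ((\<lambda>N. sqnorm (D N)) ` S)"
    by auto
  with \<open>finite S\<close> have E: "E \<in> S" "\<And>N. N \<in> S \<Longrightarrow> sqnorm (D N) \<le> sqnorm (D E)"
    by simp_all
  then obtain i where i: "i \<in> J" "a i E \<noteq> 0" by (auto simp: S_def)
  have E_ne: "sqnorm (D E) > 0"
    using E(2)[OF \<open>M \<in> S\<close>] ne sqnorm_eq_0_iff[of "D M"] by (auto simp: D_def)
  have DDE: "D (D E) = D E + D E" by (simp add: D_def)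
  \<comment> \<open>\<open>D N\<close> and \<open>D (D E - N)\<close> have midpoint \<open>D E\<close>, so both equal it by maximality.\<close>
  have diag: "D E - N = mset_star N"
    if "N \<subseteq># D E" "a j N \<noteq> 0" "a j (mset_star (D E - N)) \<noteq> 0" "j \<in> J" for j N
  proof -
    have "N \<in> S" "mset_star (D E - N) \<in> S" using that by (auto simp: S_def)
    then have le: "sqnorm (D N) \<le> sqnorm (D E)" "sqnorm (D (D E - N)) \<le> sqnorm (D E)"
      using E(2)[of N] E(2)[of "mset_star (D E - N)"] by (auto simp: D_star)
    have "D N + D (D E - N) = D (N + (D E - N))" by (simp add: D_def)
    also have "\<dots> = D E + D E" using that(1) DDE by simp
    finally have "D N = D E" using le by (rule sqnorm_strict_convex)
    then show ?thesis by (metis D_def add_diff_cancel_left')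
  qed
  have "finite {N. N \<subseteq># D E}" by (rule finite_submultisets)
  have summand: "tw N (D E - N) * a j N * cnj (a j (mset_star (D E - N))) =
      of_real (if D E - N = mset_star N then (cmod (a j N))\<^sup>2 else 0)"
    if "N \<subseteq># D E" "j \<in> J" for j N
    using diag[of N j] that by (auto simp: tw complex_norm_square mult.assoc simp del: of_real_power)
  define T where "T = (\<Sum>j\<in>J. \<Sum>N | N \<subseteq># D E. if D E - N = mset_star N then (cmod (a j N))\<^sup>2 else 0)"
  have "a k (D E) = of_real T"
    unfolding eq[of "D E"] T_def of_real_sum by (intro sum.cong refl summand) auto
  moreover have "a k (D E) = 0"
  proof (rule ccontr)
    assume "a k (D E) \<noteq> 0"
    then have "D E \<in> S" using k by (auto simp: S_def)
    from E(2)[OF this] E_ne show False by (simp add: DDE sqnorm_double)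
  qed
  ultimately have "T = 0" by simp
  moreover have "0 < (\<Sum>N | N \<subseteq># D E. if D E - N = mset_star N then (cmod (a i N))\<^sup>2 else 0)"
    by (rule sum_pos2[of _ E]) (use i \<open>finite {N. N \<subseteq># D E}\<close> in \<open>auto simp: D_def\<close>)
  then have "0 < T"
    unfolding T_def by (intro sum_pos2[OF fin(1) i(1)] sum_nonneg) auto
  ultimately show False by simp
qed

section \<open>Phases of words\<close>

text \<open>The relations say \<open>g h = cis (pairing \<theta> g h) h g\<close> for all pairs of generators; \<open>z\<close> has charge 1,
  \<open>zbar\<close> charge -1 and \<open>x\<close> charge 0.\<close>

fun pairing :: "(nat \<Rightarrow> nat \<Rightarrow> real) \<Rightarrow> gen \<Rightarrow> gen \<Rightarrow> real" where
  "pairing \<theta> (Z p) (Z q) = \<theta> p q"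
| "pairing \<theta> (Zbar p) (Zbar q) = \<theta> p q"
| "pairing \<theta> (Z p) (Zbar q) = - \<theta> p q"
| "pairing \<theta> (Zbar p) (Z q) = - \<theta> p q"
| "pairing \<theta> X h = 0"
| "pairing \<theta> g X = 0"

definition mset_pairing :: "(nat \<Rightarrow> nat \<Rightarrow> real) \<Rightarrow> gen multiset \<Rightarrow> gen multiset \<Rightarrow> real" where
  "mset_pairing \<theta> M N = (\<Sum>g\<in>#M. \<Sum>h\<in>#N. pairing \<theta> g h)"

fun word_angle :: "(nat \<Rightarrow> nat \<Rightarrow> real) \<Rightarrow> gen list \<Rightarrow> real" where
  "word_angle \<theta> [] = 0"
| "word_angle \<theta> (g # w) = mset_pairing \<theta> {#g#} (mset w) + word_angle \<theta> w"

text \<open>Half of the commutation angle is attributed to each ordered pair of letters (Weyl ordering), so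
  that interchanging two neighbouring letters multiplies by the full commutation phase. For skew \<open>\<theta>\<close>, this choice
  makes phases compatible with the involution: the phase of \<open>w*\<close> is the conjugate of that of \<open>w\<close>.\<close>

definition phase :: "(nat \<Rightarrow> nat \<Rightarrow> real) \<Rightarrow> gen list \<Rightarrow> complex" where
  "phase \<theta> w = cis (word_angle \<theta> w / 2)"

definition twist :: "(nat \<Rightarrow> nat \<Rightarrow> real) \<Rightarrow> gen multiset \<Rightarrow> gen multiset \<Rightarrow> complex" where
  "twist \<theta> M N = cis (mset_pairing \<theta> M N / 2)"

lemma mset_pairing_empty [simp]: "mset_pairing \<theta> {#} N = 0" "mset_pairing \<theta> M {#} = 0"
  by (simp_all add: mset_pairing_def)

lemma mset_pairing_add:
  "mset_pairing \<theta> (M + M') N = mset_pairing \<theta> M N + mset_pairing \<theta> M' N"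
  "mset_pairing \<theta> M (N + N') = mset_pairing \<theta> M N + mset_pairing \<theta> M N'"
  by (simp_all add: mset_pairing_def sum_mset.distrib)

lemma mset_pairing_single [simp]: "mset_pairing \<theta> {#g#} {#h#} = pairing \<theta> g h"
  by (simp add: mset_pairing_def)

lemma mset_pairing_add_mset:
  "mset_pairing \<theta> (add_mset g M) N = mset_pairing \<theta> {#g#} N + mset_pairing \<theta> M N"
  "mset_pairing \<theta> M (add_mset h N) = mset_pairing \<theta> M {#h#} + mset_pairing \<theta> M N"
  by (metis add_mset_add_single add.commute mset_pairing_add(1))
    (metis add_mset_add_single add.commute mset_pairing_add(2))

lemma pairing_star:
  "pairing \<theta> g (gen_star h) = - pairing \<theta> g h"
  "pairing \<theta> (gen_star g) = (\<lambda>h. - pairing \<theta> g h)"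
  by (cases g; cases h; simp) (rule ext, rename_tac h, cases g; case_tac h; simp)

lemma sum_mset_uminus: "(\<Sum>x\<in>#M. - f x) = - (\<Sum>x\<in>#M. f x :: real)"
  by (induction M) auto

lemma mset_pairing_star:
  "mset_pairing \<theta> (mset_star M) N = - mset_pairing \<theta> M N"
  "mset_pairing \<theta> M (mset_star N) = - mset_pairing \<theta> M N"
proof -
  show "mset_pairing \<theta> (mset_star M) N = - mset_pairing \<theta> M N"
    by (induction M) (simp_all add: mset_pairing_def pairing_star(2) sum_mset_uminus)
  have "(\<Sum>h\<in>#mset_star N. pairing \<theta> g h) = - (\<Sum>h\<in>#N. pairing \<theta> g h)" for g
    by (induction N) (simp_all add: pairing_star(1))
  then show "mset_pairing \<theta> M (mset_star N) = - mset_pairing \<theta> M N"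
    by (simp add: mset_pairing_def sum_mset_uminus)
qed

lemma word_angle_append:
  "word_angle \<theta> (u @ v) = word_angle \<theta> u + word_angle \<theta> v + mset_pairing \<theta> (mset u) (mset v)"
  by (induction u) (simp_all add: mset_pairing_add mset_pairing_add_mset(1)[of \<theta> _ "mset _"])

lemma phase_append: "phase \<theta> (u @ v) = phase \<theta> u * phase \<theta> v * twist \<theta> (mset u) (mset v)"
  by (simp add: phase_def twist_def word_angle_append cis_mult add_divide_distrib)

lemma phase_simps [simp]: "phase \<theta> w * cnj (phase \<theta> w) = 1" "phase \<theta> [] = 1"
  by (simp_all add: phase_def cis_cnj cis_mult)

locale skew_form =
  fixes \<theta> :: "nat \<Rightarrow> nat \<Rightarrow> real"
  assumes skew: "\<theta> q p = - \<theta> p q"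
begin

lemma pairing_skew: "pairing \<theta> h g = - pairing \<theta> g h"
  by (cases g; cases h; simp; metis skew minus_minus)

lemma mset_pairing_skew: "mset_pairing \<theta> N M = - mset_pairing \<theta> M N"
proof -
  have "mset_pairing \<theta> N M = (\<Sum>g\<in>#M. \<Sum>h\<in>#N. pairing \<theta> h g)"
    by (simp add: mset_pairing_def sum_mset.swap[of _ N])
  also have "\<dots> = - mset_pairing \<theta> M N"
    unfolding mset_pairing_def sum_mset_uminus[symmetric]
    by (intro arg_cong[of _ _ sum_mset] image_mset_cong pairing_skew)
  finally show ?thesis .
qed

text \<open>\<open>M*\<close> has the opposite charges to \<open>M\<close>, and the form is alternating. This is the algebraic
  counterpart of \<open>m m*\<close> being a product of the central elements \<open>z\<^sub>p z\<^sub>p*\<close> and \<open>x\<close>: no phase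
  disturbs the positivity of the leading coefficient.\<close>

lemma twist_star_self: "twist \<theta> M (mset_star M) = 1"
  using mset_pairing_skew[of M M] by (simp add: twist_def mset_pairing_star)

lemma word_angle_star: "word_angle \<theta> (rev (map gen_star w)) = - word_angle \<theta> w"
proof (induction w)
  case (Cons g w)
  have "mset_pairing \<theta> (mset_star (mset w)) (mset_star {#g#}) = mset_pairing \<theta> (mset w) {#g#}"
    by (simp only: mset_pairing_star minus_minus)
  also have "\<dots> = - mset_pairing \<theta> {#g#} (mset w)"
    by (rule mset_pairing_skew)
  finally have "mset_pairing \<theta> (mset_star (mset w)) {#gen_star g#} = - mset_pairing \<theta> {#g#} (mset w)"
    by simp
  then show ?case
    using Cons.IH by (simp add: word_angle_append)
qed simp

lemma phase_star: "phase \<theta> (rev (map gen_star w)) = cnj (phase \<theta> w)"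
  by (simp add: phase_def word_angle_star cis_cnj)

end

section \<open>Coefficients in the free algebra\<close>

text \<open>The coefficient of \<open>f\<close> at the Weyl-ordered monomial with letters \<open>M\<close>, once the letters of every word
  have been rearranged by means of the relations.\<close>

definition coef :: "(nat \<Rightarrow> nat \<Rightarrow> real) \<Rightarrow> gen multiset \<Rightarrow> ncpoly \<Rightarrow> complex" where
  "coef \<theta> M f = (\<Sum>w\<in>Poly_Mapping.keys f. if mset w = M then Poly_Mapping.lookup f w * phase \<theta> w else 0)"

lemma coef_superset:
  assumes "finite U" "Poly_Mapping.keys f \<subseteq> U"
  shows "coef \<theta> M f = (\<Sum>w\<in>U. if mset w = M then Poly_Mapping.lookup f w * phase \<theta> w else 0)"
  unfolding coef_def using assms
  by (intro sum.mono_neutral_left) (auto simp: in_keys_iff)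

lemma coef_add: "coef \<theta> M (f + g) = coef \<theta> M f + coef \<theta> M g"
proof -
  define U where "U = Poly_Mapping.keys f \<union> Poly_Mapping.keys g"
  have "finite U" "Poly_Mapping.keys f \<subseteq> U" "Poly_Mapping.keys g \<subseteq> U" "Poly_Mapping.keys (f + g) \<subseteq> U"
    using Poly_Mapping.keys_add[of f g] by (auto simp: U_def)
  then show ?thesis
    by (simp only: coef_superset[of U] sum.distrib[symmetric])
      (intro sum.cong refl, simp add: Poly_Mapping.lookup_add distrib_right)
qed

lemma coef_zero [simp]: "coef \<theta> M 0 = 0"
  by (simp add: coef_def)

lemma coef_uminus: "coef \<theta> M (- f) = - coef \<theta> M f"
  using coef_add[of \<theta> M f "- f"] by (simp add: eq_neg_iff_add_eq_0 add.commute)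

lemma coef_diff: "coef \<theta> M (f - g) = coef \<theta> M f - coef \<theta> M g"
  using coef_add[of \<theta> M f "- g"] by (simp add: coef_uminus)

lemma coef_single: "coef \<theta> M (Poly_Mapping.single w c) = (if mset w = M then c * phase \<theta> w else 0)"
  by (simp add: coef_superset[of "{w}"])

lemma coef_sum: "coef \<theta> M (sum f A) = (\<Sum>i\<in>A. coef \<theta> M (f i))"
  by (induction A rule: infinite_finite_induct) (auto simp: coef_add)

lemma finite_coef_support: "finite {M. coef \<theta> M f \<noteq> 0}"
proof (rule finite_subset)
  show "{M. coef \<theta> M f \<noteq> 0} \<subseteq> mset ` Poly_Mapping.keys f"
    by (force simp: coef_def intro: sum.neutral)
qed simp

lemma sum_of_words: "f = (\<Sum>w\<in>Poly_Mapping.keys f. Poly_Mapping.single w (Poly_Mapping.lookup f w))" for f :: ncpoly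
  by (rule poly_mapping_eqI) (auto simp: lookup_sum lookup_single when_def in_keys_iff sum.delta)

text \<open>The product is the convolution on multisets deformed by a bicharacter (the Moyal product).\<close>

lemma coef_mult:
  "coef \<theta> M (f * g) =
    (\<Sum>N | N \<subseteq># M. twist \<theta> N (M - N) * coef \<theta> N f * coef \<theta> (M - N) g)"
proof -
  let ?F = "Poly_Mapping.keys f" and ?G = "Poly_Mapping.keys g"
  let ?t = "\<lambda>u v N. twist \<theta> N (M - N) * (if mset u = N then Poly_Mapping.lookup f u * phase \<theta> u else 0) *
    (if mset v = M - N then Poly_Mapping.lookup g v * phase \<theta> v else 0)"
  have "f * g = (\<Sum>u\<in>?F. Poly_Mapping.single u (Poly_Mapping.lookup f u)) * (\<Sum>v\<in>?G. Poly_Mapping.single v (Poly_Mapping.lookup g v))"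
    using sum_of_words[of f] sum_of_words[of g] by simp
  also have "\<dots> = (\<Sum>u\<in>?F. \<Sum>v\<in>?G. Poly_Mapping.single (u @ v) (Poly_Mapping.lookup f u * Poly_Mapping.lookup g v))"
    by (simp add: sum_product mult_single plus_list_def)
  finally have "coef \<theta> M (f * g) =
      (\<Sum>u\<in>?F. \<Sum>v\<in>?G. coef \<theta> M (Poly_Mapping.single (u @ v) (Poly_Mapping.lookup f u * Poly_Mapping.lookup g v)))"
    by (simp add: coef_sum)
  also have "\<dots> = (\<Sum>u\<in>?F. \<Sum>v\<in>?G. \<Sum>N | N \<subseteq># M. ?t u v N)"
  proof (intro sum.cong refl)
    fix u v
    have "(\<Sum>N | N \<subseteq># M. ?t u v N) =
        (\<Sum>N | N \<subseteq># M. if mset u = N then twist \<theta> N (M - N) * (Poly_Mapping.lookup f u * phase \<theta> u) *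
           (if mset v = M - N then Poly_Mapping.lookup g v * phase \<theta> v else 0) else 0)"
      by (intro sum.cong refl) auto
    also have "\<dots> = (if mset u \<subseteq># M then twist \<theta> (mset u) (M - mset u) * (Poly_Mapping.lookup f u * phase \<theta> u) *
           (if mset v = M - mset u then Poly_Mapping.lookup g v * phase \<theta> v else 0) else 0)"
      by (simp add: sum.delta' finite_submultisets)
    also have "\<dots> = coef \<theta> M (Poly_Mapping.single (u @ v) (Poly_Mapping.lookup f u * Poly_Mapping.lookup g v))"
    proof (cases "mset u + mset v = M")
      case True
      then show ?thesis by (auto simp: coef_single phase_append)
    next
      case False
      then have "mset v \<noteq> M - mset u" if "mset u \<subseteq># M"
        using that by (auto simp: subset_mset.add_diff_inverse)
      with False show ?thesis by (simp add: coef_single)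
    qed
    finally show "coef \<theta> M (Poly_Mapping.single (u @ v) (Poly_Mapping.lookup f u * Poly_Mapping.lookup g v)) =
      (\<Sum>N | N \<subseteq># M. ?t u v N)" ..
  qed
  also have "\<dots> = (\<Sum>u\<in>?F. \<Sum>N | N \<subseteq># M. \<Sum>v\<in>?G. ?t u v N)"
    by (intro sum.cong refl sum.swap)
  also have "\<dots> = (\<Sum>N | N \<subseteq># M. \<Sum>u\<in>?F. \<Sum>v\<in>?G. ?t u v N)"
    by (rule sum.swap)
  also have "\<dots> = (\<Sum>N | N \<subseteq># M. twist \<theta> N (M - N) * coef \<theta> N f * coef \<theta> (M - N) g)"
    by (simp only: coef_def sum_distrib_left sum_distrib_right mult.assoc)
      (intro sum.cong refl sum.swap)
  finally show ?thesis .
qed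

lemma lookup_nc_star: "Poly_Mapping.lookup (nc_star f) w = cnj (Poly_Mapping.lookup f (rev (map gen_star w)))"
proof -
  have eq: "rev (map gen_star u) = w \<longleftrightarrow> u = rev (map gen_star w)" for u
    by (auto simp: rev_map)
  show ?thesis
    by (simp add: nc_star_def lookup_sum lookup_single when_def eq in_keys_iff)
qed

lemma nc_star_diff: "nc_star (f - g) = nc_star f - nc_star g"
  by (rule poly_mapping_eqI) (simp add: lookup_nc_star lookup_minus)

lemma nc_star_single: "nc_star (Poly_Mapping.single w c) = Poly_Mapping.single (rev (map gen_star w)) (cnj c)"
  by (cases "c = 0") (simp_all add: nc_star_def)

lemma nc_star_closed:
  "f \<in> carrier (free_star_algebra n) \<Longrightarrow> nc_star f \<in> carrier (free_star_algebra n)"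
proof -
  assume f: "f \<in> carrier (free_star_algebra n)"
  have "set w \<subseteq> gens n" if "w \<in> Poly_Mapping.keys (nc_star f)" for w
  proof -
    have "rev (map gen_star w) \<in> Poly_Mapping.keys f"
      using that by (simp add: in_keys_iff lookup_nc_star)
    with f have "set (rev (map gen_star w)) \<subseteq> gens n"
      unfolding free_star_algebra_def partial_object.simps by blast
    then show ?thesis by (simp add: image_subset_iff) blast
  qed
  then show ?thesis by (simp add: free_star_algebra_def)
qed

context skew_form
begin

lemma coef_star: "coef \<theta> M (nc_star f) = cnj (coef \<theta> (mset_star M) f)"
proof -
  have eq: "mset_star (mset w) = M \<longleftrightarrow> mset w = mset_star M" for w
  proof
    assume "mset_star (mset w) = M"
    then have "mset_star (mset_star (mset w)) = mset_star M" by (rule arg_cong)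
    then show "mset w = mset_star M" by (simp only: mset_star_involution)
  next
    assume "mset w = mset_star M"
    then show "mset_star (mset w) = M" by (simp only: mset_star_involution)
  qed
  have "coef \<theta> M (nc_star f) = (\<Sum>w\<in>Poly_Mapping.keys f.
      if mset_star (mset w) = M then cnj (Poly_Mapping.lookup f w) * cnj (phase \<theta> w) else 0)"
    unfolding nc_star_def coef_sum coef_single phase_star by simp
  also have "\<dots> = cnj (coef \<theta> (mset_star M) f)"
    unfolding coef_def cnj_sum eq by (intro sum.cong) auto
  finally show ?thesis .
qed

text \<open>Coefficients of \<open>f g*\<close> in the shape required by the positivity argument.\<close>

lemma coef_mult_star:
  "coef \<theta> M (f * nc_star g) =
    (\<Sum>N | N \<subseteq># M. twist \<theta> N (M - N) * coef \<theta> N f * cnj (coef \<theta> (mset_star (M - N)) g))"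
  by (simp add: coef_mult coef_star)

end

section \<open>Quotients and subalgebras\<close>

text \<open>The operator \<^const>\<open>finsum\<close> is defined through the carrier, so its value in a subring is not the
  same by definition.\<close>

lemma (in ring) finsum_subring:
  assumes "subring H R" "finite F" "f \<in> F \<rightarrow> H"
  shows "finsum (R\<lparr>carrier := H\<rparr>) f F = finsum R f F"
  using assms(2,3)
proof (induction F)
  interpret H: ring "R\<lparr>carrier := H\<rparr>" by (rule subring_is_ring[OF assms(1)])
  {
    case empty
    show ?case by simp
  next
    case (insert i F)
    have "H \<subseteq> carrier R" by (rule subringE(1)[OF assms(1)])
    with insert have "f \<in> F \<rightarrow> carrier R" "f i \<in> carrier R" "f \<in> F \<rightarrow> H" "f i \<in> H" by auto
    with insert show ?case by simp
  }
qed

lemma projectors_subring: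
  fixes A :: "'a star_algebra"
  assumes "ring A" "subring H A" "P \<in> projectors A" "elements_mat P \<subseteq> H"
  shows "P \<in> projectors (A\<lparr>carrier := H\<rparr>)"
proof -
  interpret A: ring A by fact
  have sq: "dim_col P = dim_row P" using assms(3) by (simp add: projectors_def)
  have entry: "P $$ (k, l) \<in> H" if "k < dim_row P" "l < dim_col P" for k l
    using assms(4) that elements_matI[OF carrier_matI, of P _ _ k l] by blast
  have "star_mat_mult (A\<lparr>carrier := H\<rparr>) P P = star_mat_mult A P P"
    unfolding star_mat_mult_def
  proof (intro eq_matI; simp)
    fix k l assume "k < dim_row P" "l < dim_col P"
    then show "finsum (A\<lparr>carrier := H\<rparr>) (\<lambda>j. P $$ (k, j) \<otimes>\<^bsub>A\<^esub> P $$ (j, l)) {..<dim_col P} =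
        finsum A (\<lambda>j. P $$ (k, j) \<otimes>\<^bsub>A\<^esub> P $$ (j, l)) {..<dim_col P}"
      by (intro A.finsum_subring assms(2))
        (auto simp: sq intro!: subringE(6)[OF assms(2)] entry)
  qed
  moreover have "star_mat_adjoint (A\<lparr>carrier := H\<rparr>) P = star_mat_adjoint A P"
    by (simp add: star_mat_adjoint_def)
  ultimately show ?thesis
    using assms(3,4) by (simp add: projectors_def)
qed

lemma ring_star_quot:
  assumes "ideal I A"
  shows "ring (star_quot A I)"
proof -
  interpret Q: ring "A Quot I" by (rule ideal.quotient_is_ring[OF assms])
  show ?thesis
  proof (rule ringI)
    show "abelian_group (star_quot A I)"
    proof (rule abelian_groupI)
      fix C assume "C \<in> carrier (star_quot A I)"
      then show "\<exists>D\<in>carrier (star_quot A I). D \<oplus>\<^bsub>star_quot A I\<^esub> C = \<zero>\<^bsub>star_quot A I\<^esub>"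
        by (intro bexI[of _ "\<ominus>\<^bsub>A Quot I\<^esub> C"]) (simp_all add: star_quot_def Q.l_neg)
    qed (simp_all add: star_quot_def Q.a_ac)
    show "Group.monoid (star_quot A I)"
      by (rule monoidI) (simp_all add: star_quot_def Q.m_assoc)
  qed (simp_all add: star_quot_def Q.l_distr Q.r_distr)
qed

section \<open>The ideal of relations\<close>

text \<open>Cutting off outside the index range makes the form skew on all of \<^typ>\<open>nat\<close>, since entries of a matrix
  outside its dimensions are unspecified.\<close>

definition angle :: "nat \<Rightarrow> real mat \<Rightarrow> nat \<Rightarrow> nat \<Rightarrow> real" where
  "angle n \<Theta> p q = (if p < n \<and> q < n then \<Theta> $$ (p, q) else 0)"

locale theta_plane =
  fixes n :: nat and \<Theta> :: "real mat"
  assumes dim: "\<Theta> \<in> carrier_mat n n" and skew_mat: "transpose_mat \<Theta> = - \<Theta>"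
begin

abbreviation A :: "ncpoly star_algebra" where "A \<equiv> free_star_algebra n"
abbreviation I :: "ncpoly set" where "I \<equiv> star_ideal A (theta_relations n \<Theta>)"
abbreviation \<theta> :: "nat \<Rightarrow> nat \<Rightarrow> real" where "\<theta> \<equiv> angle n \<Theta>"

sublocale skew_form \<theta>
proof
  fix p q
  have "\<Theta> $$ (q, p) = - \<Theta> $$ (p, q)" if "p < n" "q < n"
    using that dim arg_cong[OF skew_mat, of "\<lambda>M. M $$ (p, q)"] by simp
  then show "\<theta> q p = - \<theta> p q" by (simp add: angle_def)
qed

sublocale A: ring A by (rule ring_free_star_algebra)

lemma A_ops: "f \<otimes>\<^bsub>A\<^esub> g = f * g" "f \<oplus>\<^bsub>A\<^esub> g = f + g" "\<one>\<^bsub>A\<^esub> = 1" "\<zero>\<^bsub>A\<^esub> = 0"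
  "star A f = nc_star f" "c \<odot>\<^bsub>A\<^esub> f = nc_const c * f"
  by (simp_all add: free_star_algebra_def)

lemma A_closed:
  "f \<in> carrier A \<Longrightarrow> g \<in> carrier A \<Longrightarrow> f * g \<in> carrier A"
  "f \<in> carrier A \<Longrightarrow> g \<in> carrier A \<Longrightarrow> f + g \<in> carrier A"
  "f \<in> carrier A \<Longrightarrow> - f \<in> carrier A"
  "0 \<in> carrier A"
proof -
  show "f * g \<in> carrier A" "f + g \<in> carrier A" if "f \<in> carrier A" "g \<in> carrier A"
    using A.m_closed[OF that] A.a_closed[OF that] unfolding A_ops by blast+
  show "0 \<in> carrier A" using A.zero_closed unfolding A_ops .
  have "Poly_Mapping.keys (- f) = Poly_Mapping.keys f"
    by (simp add: set_eq_iff in_keys_iff)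
  then show "- f \<in> carrier A" if "f \<in> carrier A"
    using that by (simp add: free_star_algebra_def)
qed

lemma A_inv: "f \<in> carrier A \<Longrightarrow> \<ominus>\<^bsub>A\<^esub> f = - f"
  by (rule A.minus_equality) (simp_all add: A_ops A_closed)

lemma single_closed: "set w \<subseteq> gens n \<Longrightarrow> Poly_Mapping.single w c \<in> carrier A"
  by (simp add: free_star_algebra_def)

lemma const_closed: "nc_const c \<in> carrier A"
  by (simp add: nc_const_def single_closed)

definition commutation :: "gen \<Rightarrow> gen \<Rightarrow> ncpoly" where
  "commutation g h = Poly_Mapping.single [g, h] 1 - Poly_Mapping.single [h, g] (cis (pairing \<theta> g h))"

lemma theta_relations_eq:
  "theta_relations n \<Theta> =
    {commutation (Z p) (Z q) | p q. p < n \<and> q < n} \<union>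
    {commutation (Zbar p) (Zbar q) | p q. p < n \<and> q < n} \<union>
    {commutation (Zbar p) (Z q) | p q. p < n \<and> q < n} \<union>
    {commutation X (Z p) | p. p < n}"
proof -
  have lam: "lam \<Theta> p q = cis (\<theta> p q)" if "p < n" "q < n" for p q
    using that by (simp add: lam_def angle_def cis_conv_exp)
  note prod = nc_gen_def nc_const_def mult_single plus_list_def commutation_def
  have "nc_gen (Z p) * nc_gen (Z q) - nc_const (lam \<Theta> p q) * (nc_gen (Z q) * nc_gen (Z p)) =
      commutation (Z p) (Z q)"
    "nc_gen (Zbar p) * nc_gen (Zbar q) - nc_const (lam \<Theta> p q) * (nc_gen (Zbar q) * nc_gen (Zbar p)) =
      commutation (Zbar p) (Zbar q)"
    "nc_gen (Zbar p) * nc_gen (Z q) - nc_const (lam \<Theta> q p) * (nc_gen (Z q) * nc_gen (Zbar p)) =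
      commutation (Zbar p) (Z q)" if "p < n \<and> q < n" for p q
    using that by (simp_all add: lam prod skew[of p q])
  note rels = this
  have "nc_gen X * nc_gen (Z p) - nc_gen (Z p) * nc_gen X = commutation X (Z p)" for p
    by (simp add: prod)
  note rels = rels this
  show ?thesis
    unfolding theta_relations_def
    by (intro arg_cong2[of _ _ _ _ "(\<union>)"] Collect_cong ex_cong1 refl) (auto simp: rels)
qed

lemma coef_commutation: "coef \<theta> M (commutation g h) = 0"
  using pairing_skew[of h g]
  by (simp add: commutation_def coef_diff coef_single phase_def cis_mult add_mset_commute)

text \<open>The elements with no nonzero coefficient form an ideal that contains the relations and their
  adjoints, hence the ideal generated by them. Coefficients therefore descend to the quotient; this
  replaces the linear independence of ordered monomials.\<close>

definition coef_kernel :: "ncpoly set" where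
  "coef_kernel = {f \<in> carrier A. \<forall>M. coef \<theta> M f = 0}"

lemma ideal_coef_kernel: "ideal coef_kernel A"
proof (rule idealI)
  show "ring A" by (rule A.ring_axioms)
  show "subgroup coef_kernel (add_monoid A)"
  proof (rule A.add.subgroupI)
    fix f assume "f \<in> coef_kernel"
    then show "\<ominus>\<^bsub>A\<^esub> f \<in> coef_kernel"
      by (simp add: A_inv coef_kernel_def A_closed coef_uminus)
  qed (auto simp: coef_kernel_def A_ops A_closed coef_add intro: A_closed(4))
qed (simp_all add: coef_kernel_def A_ops A_closed coef_mult)

lemma generators_closed: "theta_relations n \<Theta> \<union> star A ` theta_relations n \<Theta> \<subseteq> carrier A"
  using theta_relations_subset[of n \<Theta>] nc_star_closed[of _ n] by (auto simp: A_ops)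

sublocale I: ideal I A
  unfolding star_ideal_def by (rule A.genideal_ideal[OF generators_closed])

lemma generators_in_ideal:
  "r \<in> theta_relations n \<Theta> \<Longrightarrow> r \<in> I" "r \<in> theta_relations n \<Theta> \<Longrightarrow> nc_star r \<in> I"
  using A.genideal_self[OF generators_closed] by (auto simp: star_ideal_def A_ops)

lemma ideal_subset_coef_kernel: "I \<subseteq> coef_kernel"
  unfolding star_ideal_def
proof (rule A.genideal_minimal[OF ideal_coef_kernel])
  have "coef \<theta> M r = 0" if "r \<in> theta_relations n \<Theta>" for M r
    using that coef_commutation unfolding theta_relations_eq by blast
  then show "theta_relations n \<Theta> \<union> star A ` theta_relations n \<Theta> \<subseteq> coef_kernel"
    using generators_closed by (auto simp: coef_kernel_def A_ops coef_star)
qed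

lemma I_closed:
  "0 \<in> I"
  "f \<in> I \<Longrightarrow> g \<in> I \<Longrightarrow> f + g \<in> I"
  "f \<in> I \<Longrightarrow> - f \<in> I"
  "f \<in> I \<Longrightarrow> g \<in> I \<Longrightarrow> f - g \<in> I"
  "f \<in> I \<Longrightarrow> g \<in> carrier A \<Longrightarrow> g * f \<in> I"
  "f \<in> I \<Longrightarrow> g \<in> carrier A \<Longrightarrow> f * g \<in> I"
proof -
  show zero: "0 \<in> I" using I.zero_closed by (simp add: A_ops)
  show add: "f + g \<in> I" if "f \<in> I" "g \<in> I" for f g using I.a_closed[OF that] by (simp add: A_ops)
  show inv: "- f \<in> I" if "f \<in> I" for f using I.a_inv_closed[OF that] that by (simp add: A_inv)
  show "f - g \<in> I" if "f \<in> I" "g \<in> I" using add[OF that(1) inv[OF that(2)]] by simp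
  show "g * f \<in> I" if "f \<in> I" "g \<in> carrier A" using I.I_l_closed[OF that] by (simp add: A_ops)
  show "f * g \<in> I" if "f \<in> I" "g \<in> carrier A" using I.I_r_closed[OF that] by (simp add: A_ops)
qed

lemma I_sum: "(\<And>i. i \<in> F \<Longrightarrow> f i \<in> I) \<Longrightarrow> sum f F \<in> I"
  by (induction F rule: infinite_finite_induct) (auto intro: I_closed)

section \<open>Rearranging words modulo the relations\<close>

text \<open>The normalisation that makes all rearrangements of a word represent the same element of the
  quotient.\<close>

definition weyl_word :: "gen list \<Rightarrow> ncpoly" where
  "weyl_word w = Poly_Mapping.single w (cnj (phase \<theta> w))"

lemma weyl_word_append:
  "weyl_word (u @ v) = nc_const (cnj (twist \<theta> (mset u) (mset v))) * (weyl_word u * weyl_word v)"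
  by (simp add: weyl_word_def nc_const_def mult_single plus_list_def phase_append mult_ac)

lemma weyl_word_closed: "set w \<subseteq> gens n \<Longrightarrow> weyl_word w \<in> carrier A"
  by (simp add: weyl_word_def single_closed)

lemma weyl_word_append_cong:
  assumes "weyl_word u - weyl_word u' \<in> I" "mset u = mset u'" "set v \<subseteq> gens n"
  shows "weyl_word (v @ u) - weyl_word (v @ u') \<in> I" "weyl_word (u @ v) - weyl_word (u' @ v) \<in> I"
proof -
  have "weyl_word (v @ u) - weyl_word (v @ u') =
      nc_const (cnj (twist \<theta> (mset v) (mset u))) * (weyl_word v * (weyl_word u - weyl_word u'))"
    by (simp add: weyl_word_append assms(2) right_diff_distrib)
  then show "weyl_word (v @ u) - weyl_word (v @ u') \<in> I"
    using assms(1,3) by (simp add: I_closed const_closed weyl_word_closed)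
  have "weyl_word (u @ v) - weyl_word (u' @ v) =
      nc_const (cnj (twist \<theta> (mset u) (mset v))) * ((weyl_word u - weyl_word u') * weyl_word v)"
    by (simp add: weyl_word_append assms(2) right_diff_distrib left_diff_distrib)
  then show "weyl_word (u @ v) - weyl_word (u' @ v) \<in> I"
    using assms(1,3) by (simp add: I_closed const_closed weyl_word_closed)
qed

lemma weyl_word_two:
  "weyl_word [g, h] - weyl_word [h, g] = nc_const (cis (- pairing \<theta> g h / 2)) * commutation g h"
  using pairing_skew[of h g]
  by (simp add: weyl_word_def nc_const_def phase_def right_diff_distrib mult_single plus_list_def
      cis_cnj cis_mult commutation_def)

text \<open>The defining relations cover only some ordered pairs of generators. The others come from
  symmetry and, for \<open>x\<close> and \<open>zbar\<^sub>p\<close>, from the adjoint of the relation between \<open>x\<close> and \<open>z\<^sub>p\<close>.\<close>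

lemma weyl_word_swap:
  assumes "g \<in> gens n" "h \<in> gens n"
  shows "weyl_word [g, h] - weyl_word [h, g] \<in> I"
proof -
  define comm where "comm = (\<lambda>g h. weyl_word [g, h] - weyl_word [h, g] \<in> I)"
  have rel: "comm g h" if "commutation g h \<in> I" for g h
    unfolding comm_def weyl_word_two using that by (intro I_closed const_closed)
  have sym: "comm h g" if "comm g h" for g h
    using I_closed(3)[of "weyl_word [g, h] - weyl_word [h, g]"] that by (simp add: comm_def)
  have zz: "comm (Z p) (Z q)" "comm (Zbar p) (Zbar q)" "comm (Zbar p) (Z q)" if "p < n" "q < n" for p q
    by (rule rel, rule generators_in_ideal(1), use that in \<open>unfold theta_relations_eq, blast\<close>)+
  have xz: "comm X (Z p)" "comm (Zbar p) X" if "p < n" for p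
  proof -
    have "commutation X (Z p) \<in> theta_relations n \<Theta>"
      using that unfolding theta_relations_eq by blast
    then show "comm X (Z p)" "comm (Zbar p) X"
      using rel generators_in_ideal by (force simp: commutation_def nc_star_diff nc_star_single)+
  qed
  have xx: "comm X X" by (simp add: comm_def I_closed)
  have "comm g h"
    using assms zz xz xx sym unfolding gens_def by blast
  then show ?thesis by (simp add: comm_def)
qed

lemma weyl_word_trans:
  "weyl_word u - weyl_word v \<in> I \<Longrightarrow> weyl_word v - weyl_word w \<in> I \<Longrightarrow> weyl_word u - weyl_word w \<in> I"
  using I_closed(2)[of "weyl_word u - weyl_word v" "weyl_word v - weyl_word w"] by simp

lemma weyl_word_move:
  assumes "g \<in> gens n" "set v \<subseteq> gens n" "set w \<subseteq> gens n"
  shows "weyl_word (g # v @ w) - weyl_word (v @ g # w) \<in> I"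
  using assms(2)
proof (induction v)
  case Nil
  show ?case by (simp add: I_closed)
next
  case (Cons h v)
  have "weyl_word (g # h # v @ w) - weyl_word (h # g # v @ w) \<in> I"
    using weyl_word_append_cong(2)[OF weyl_word_swap, of g h "v @ w"] Cons.prems assms by auto
  moreover have "weyl_word (h # g # v @ w) - weyl_word (h # v @ g # w) \<in> I"
    using weyl_word_append_cong(1)[OF Cons.IH, of "[h]"] Cons.prems by simp
  ultimately show ?case by simp (rule weyl_word_trans)
qed

text \<open>Insertion sort by interchanges of neighbours.\<close>

lemma weyl_word_cong:
  assumes "mset u = mset v" "set u \<subseteq> gens n"
  shows "weyl_word u - weyl_word v \<in> I"
  using assms
proof (induction u arbitrary: v)
  case Nil
  then show ?case by (simp add: I_closed)
next
  case (Cons g u)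
  then have "g \<in> set v" by (metis list.set_intros(1) mset_eq_setD)
  then obtain v1 v2 where v: "v = v1 @ g # v2" by (meson split_list)
  with Cons.prems have eq: "mset u = mset (v1 @ v2)" by simp
  then have sets: "set v1 \<subseteq> gens n" "set v2 \<subseteq> gens n" "g \<in> gens n"
    using Cons.prems mset_eq_setD[OF eq] by auto
  have "weyl_word (g # u) - weyl_word (g # v1 @ v2) \<in> I"
    using weyl_word_append_cong(1)[OF Cons.IH[OF eq] eq, of "[g]"] Cons.prems by simp
  moreover have "weyl_word (g # v1 @ v2) - weyl_word v \<in> I"
    unfolding v using sets by (intro weyl_word_move)
  ultimately show ?case by (rule weyl_word_trans)
qed

text \<open>Modulo the ideal, \<open>f\<close> is the sum over multisets \<open>M\<close> of \<open>coef \<theta> M f\<close> times the class of the Weyl-ordered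
  words with letters \<open>M\<close>. This is the spanning half of the basis property: an element whose
  nonconstant coefficients vanish is a scalar in the quotient.\<close>

lemma constant_mod_ideal:
  assumes f: "f \<in> carrier A" and coef: "\<And>M. M \<noteq> {#} \<Longrightarrow> coef \<theta> M f = 0"
  shows "f - nc_const (coef \<theta> {#} f) \<in> I"
proof -
  \<comment> \<open>an arbitrary representative word for each multiset\<close>
  define W where "W = (\<lambda>M. SOME w :: gen list. mset w = M)"
  have mset_W: "mset (W M) = M" for M
    unfolding W_def by (rule someI_ex) (rule ex_mset)
  then have W_empty: "W {#} = []" by (metis mset_zero_iff)
  let ?K = "Poly_Mapping.keys f"
  let ?c = "\<lambda>w. Poly_Mapping.lookup f w * phase \<theta> w"
  have const_sum: "nc_const (sum c S) = (\<Sum>w\<in>S. nc_const (c w))" for c :: "gen list \<Rightarrow> complex" and S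
    by (induction S rule: infinite_finite_induct) (simp_all add: nc_const_def single_add)
  have "f = (\<Sum>w\<in>?K. nc_const (?c w) * weyl_word w)"
    by (subst sum_of_words[of f])
      (simp add: nc_const_def weyl_word_def mult_single plus_list_def mult.assoc)
  then have "f - (\<Sum>w\<in>?K. nc_const (?c w) * weyl_word (W (mset w))) =
      (\<Sum>w\<in>?K. nc_const (?c w) * (weyl_word w - weyl_word (W (mset w))))"
    by (simp add: right_diff_distrib sum_subtractf)
  also have "\<dots> \<in> I"
    using f by (intro I_sum I_closed const_closed weyl_word_cong)
      (auto simp: mset_W free_star_algebra_def)
  also have "(\<Sum>w\<in>?K. nc_const (?c w) * weyl_word (W (mset w))) =
      (\<Sum>M\<in>mset ` ?K. \<Sum>w | w \<in> ?K \<and> mset w = M. nc_const (?c w) * weyl_word (W (mset w)))"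
    by (rule sum.image_gen) simp
  also have "\<dots> = (\<Sum>M\<in>mset ` ?K. nc_const (coef \<theta> M f) * weyl_word (W M))"
    by (intro sum.cong refl)
      (simp add: coef_def const_sum sum_distrib_right flip: sum.inter_filter)
  also have "\<dots> = (\<Sum>M\<in>mset ` ?K. if M = {#} then nc_const (coef \<theta> {#} f) else 0)"
    by (intro sum.cong refl)
      (auto simp: coef W_empty weyl_word_def nc_const_def mult_single plus_list_def)
  also have "\<dots> = nc_const (coef \<theta> {#} f)"
    by (auto simp: sum.delta coef_def nc_const_def)
  finally show ?thesis .
qed

section \<open>Projectors over the quotient\<close>

abbreviation Q :: "ncpoly set star_algebra" where "Q \<equiv> C_alg_odd n \<Theta>"
abbreviation coset :: "ncpoly \<Rightarrow> ncpoly set" where "coset f \<equiv> I +>\<^bsub>A\<^esub> f"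

sublocale Q: ring Q
  unfolding C_alg_odd_def by (rule ring_star_quot[OF I.ideal_axioms])

lemma mem_coset_iff: "f \<in> carrier A \<Longrightarrow> g \<in> carrier A \<Longrightarrow> g \<in> coset f \<longleftrightarrow> g - f \<in> I"
  by (simp add: I.a_rcos_module A_inv A_ops)

lemma coset_eq_iff: "f \<in> carrier A \<Longrightarrow> g \<in> carrier A \<Longrightarrow> coset g = coset f \<longleftrightarrow> g - f \<in> I"
  using mem_coset_iff I.a_repr_independence' I.a_repr_independenceD by metis

lemma coset_subset: "f \<in> carrier A \<Longrightarrow> coset f \<subseteq> carrier A"
  using A.a_r_coset_subset_G[OF I.a_subset] by simp

lemma coset_self: "f \<in> carrier A \<Longrightarrow> f \<in> coset f"
  by (rule I.a_rcos_self)

lemma carrier_Q: "carrier Q = coset ` carrier A"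
  by (auto simp: C_alg_odd_def star_quot_def FactRing_def A_RCOSETS_def')

lemma Q_ops:
  "f \<in> carrier A \<Longrightarrow> g \<in> carrier A \<Longrightarrow> coset f \<otimes>\<^bsub>Q\<^esub> coset g = coset (f * g)"
  "f \<in> carrier A \<Longrightarrow> g \<in> carrier A \<Longrightarrow> coset f \<oplus>\<^bsub>Q\<^esub> coset g = coset (f + g)"
  "\<zero>\<^bsub>Q\<^esub> = coset 0" "\<one>\<^bsub>Q\<^esub> = coset 1"
proof -
  show "\<zero>\<^bsub>Q\<^esub> = coset 0"
    using I.a_rcos_const[OF I.zero_closed] by (simp add: C_alg_odd_def star_quot_def FactRing_def A_ops)
qed (simp_all add: C_alg_odd_def star_quot_def FactRing_def I.rcoset_mult_add I.a_rcos_sum A_ops)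

lemma sum_closed: "(\<And>i. i \<in> F \<Longrightarrow> f i \<in> carrier A) \<Longrightarrow> sum f F \<in> carrier A"
  by (induction F rule: infinite_finite_induct) (auto intro: A_closed)

lemma finsum_coset:
  assumes "finite F" "\<And>i. i \<in> F \<Longrightarrow> f i \<in> carrier A"
  shows "(\<Oplus>\<^bsub>Q\<^esub>i\<in>F. coset (f i)) = coset (sum f F)"
  using assms
proof (induction F)
  case (insert i F)
  then have "(\<lambda>i. coset (f i)) \<in> F \<rightarrow> carrier Q" "coset (f i) \<in> carrier Q"
    by (auto simp: carrier_Q)
  with insert show ?case by (simp add: Q_ops sum_closed)
qed (simp add: Q_ops)

text \<open>The involution of the quotient sends \<open>C\<close> to a union of cosets. Knowing one of its members is enough
  to compare coefficients.\<close>

lemma star_mem_star_coset: "f \<in> carrier A \<Longrightarrow> nc_star f \<in> star Q (coset f)"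
  using coset_self[of f] coset_self[OF nc_star_closed[of f n]]
  by (auto simp: C_alg_odd_def star_quot_def A_ops)

lemma smult_one: "c \<odot>\<^bsub>Q\<^esub> \<one>\<^bsub>Q\<^esub> = coset (nc_const c)"
proof -
  have one: "(1 :: ncpoly) \<in> carrier A" using A.one_closed by (simp add: A_ops)
  have "coset (nc_const c * f) = coset (nc_const c)" if "f \<in> coset 1" for f
  proof -
    have f: "f \<in> carrier A" using that coset_subset[OF one] by blast
    then have "nc_const c * (f - 1) \<in> I"
      using that one by (intro I_closed(5) const_closed) (simp add: mem_coset_iff)
    then show ?thesis
      using f by (simp add: coset_eq_iff const_closed A_closed right_diff_distrib)
  qed
  moreover have "c \<odot>\<^bsub>Q\<^esub> \<one>\<^bsub>Q\<^esub> = (\<Union>f\<in>coset 1. coset (nc_const c * f))"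
    unfolding Q_ops by (simp add: C_alg_odd_def star_quot_def A_ops)
  ultimately show ?thesis using coset_self[OF one] by auto
qed

lemma subring_scalars: "subring {c \<odot>\<^bsub>Q\<^esub> \<one>\<^bsub>Q\<^esub> | c. True} Q"
proof (rule Q.subringI)
  have const: "nc_const c * nc_const d = nc_const (c * d)" "nc_const c + nc_const d = nc_const (c + d)"
    "nc_const 0 = 0" "nc_const 1 = 1" for c d
    by (simp_all add: nc_const_def mult_single single_add plus_list_def)
      (simp_all flip: zero_list_def)
  show "{c \<odot>\<^bsub>Q\<^esub> \<one>\<^bsub>Q\<^esub> | c. True} \<subseteq> carrier Q"
    by (auto simp: smult_one carrier_Q const_closed)
  show "\<one>\<^bsub>Q\<^esub> \<in> {c \<odot>\<^bsub>Q\<^esub> \<one>\<^bsub>Q\<^esub> | c. True}"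
    unfolding smult_one by (metis (mono_tags, lifting) const(4) mem_Collect_eq Q_ops(4))
  fix C D assume "C \<in> {c \<odot>\<^bsub>Q\<^esub> \<one>\<^bsub>Q\<^esub> | c. True}" 
  then obtain c where c: "C = coset (nc_const c)" by (auto simp: smult_one)
  have "\<ominus>\<^bsub>Q\<^esub> C = coset (nc_const (- c))"
    by (rule Q.minus_equality) (simp_all add: c Q_ops const_closed const carrier_Q)
  then show "\<ominus>\<^bsub>Q\<^esub> C \<in> {c \<odot>\<^bsub>Q\<^esub> \<one>\<^bsub>Q\<^esub> | c. True}" by (auto simp: smult_one)
  assume "D \<in> {c \<odot>\<^bsub>Q\<^esub> \<one>\<^bsub>Q\<^esub> | c. True}"
  then obtain d where d: "D = coset (nc_const d)" by (auto simp: smult_one)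
  show "C \<otimes>\<^bsub>Q\<^esub> D \<in> {c \<odot>\<^bsub>Q\<^esub> \<one>\<^bsub>Q\<^esub> | c. True}" "C \<oplus>\<^bsub>Q\<^esub> D \<in> {c \<odot>\<^bsub>Q\<^esub> \<one>\<^bsub>Q\<^esub> | c. True}"
    unfolding smult_one c d by (auto simp: Q_ops const_closed const)
qed

lemma coef_cong: "f \<in> coset g \<Longrightarrow> g \<in> carrier A \<Longrightarrow> coef \<theta> M f = coef \<theta> M g"
proof -
  assume f: "f \<in> coset g" and g: "g \<in> carrier A"
  then have "f - g \<in> I" using coset_subset[OF g] by (auto simp flip: mem_coset_iff)
  then have "coef \<theta> M (f - g) = 0" using ideal_subset_coef_kernel by (auto simp: coef_kernel_def)
  then show ?thesis by (simp add: coef_diff)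
qed

text \<open>Representatives \<open>x k l\<close> of the entries have coefficients for which \<open>P = P P\<close> and \<open>P* = P\<close> hold exactly.
  Since \<open>x j k\<close> and \<open>(x k j)*\<close> have equal coefficients, the diagonal of \<open>P = P P\<close> becomes the identity
  \<open>x k k = \<Sum>j. x k j (x k j)*\<close> of coefficients, to which the positivity argument applies.\<close>

lemma projector_entries_scalar:
  assumes P: "P \<in> projectors Q"
  shows "elements_mat P \<subseteq> {c \<odot>\<^bsub>Q\<^esub> \<one>\<^bsub>Q\<^esub> | c. True}"
proof -
  define N where "N = dim_row P"
  have dims: "dim_row P = N" "dim_col P = N"
    and square: "star_mat_mult Q P P = P" and adjoint: "star_mat_adjoint Q P = P"
    using P by (simp_all add: projectors_def N_def)
  have "P $$ (k, l) \<in> carrier Q" if "k < N" "l < N" for k l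
    using that P elements_matI[OF carrier_matI[OF dims], of k l] by (auto simp: projectors_def)
  then have "\<forall>k l. \<exists>f. k < N \<longrightarrow> l < N \<longrightarrow> f \<in> carrier A \<and> P $$ (k, l) = coset f"
    unfolding carrier_Q by blast
  then obtain x where x: "\<And>k l. k < N \<Longrightarrow> l < N \<Longrightarrow> x k l \<in> carrier A"
    "\<And>k l. k < N \<Longrightarrow> l < N \<Longrightarrow> P $$ (k, l) = coset (x k l)"
    by metis
  have star: "coef \<theta> M (nc_star (x l k)) = coef \<theta> M (x k l)" if "k < N" "l < N" for k l M
  proof (rule coef_cong)
    have "P $$ (k, l) = star Q (P $$ (l, k))"
      using that arg_cong[OF adjoint, of "\<lambda>P. P $$ (k, l)"] by (simp add: star_mat_adjoint_def dims)
    then show "nc_star (x l k) \<in> coset (x k l)"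
      using star_mem_star_coset[of "x l k"] that by (simp add: x)
  qed (use that x in auto)
  have row: "coef \<theta> M (x k k) = (\<Sum>j<N. coef \<theta> M (x k j * nc_star (x k j)))" if "k < N" for k M
  proof -
    have "coset (x k k) = P $$ (k, k)" using that by (simp add: x)
    also have "\<dots> = star_mat_mult Q P P $$ (k, k)" by (simp add: square)
    also have "\<dots> = (\<Oplus>\<^bsub>Q\<^esub>j\<in>{..<N}. P $$ (k, j) \<otimes>\<^bsub>Q\<^esub> P $$ (j, k))"
      using that by (simp add: star_mat_mult_def dims)
    also have "\<dots> = (\<Oplus>\<^bsub>Q\<^esub>j\<in>{..<N}. coset (x k j * x j k))"
      by (rule Q.finsum_cong') (use that x in \<open>auto simp: Q_ops carrier_Q A_closed\<close>)
    also have "\<dots> = coset (\<Sum>j<N. x k j * x j k)"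
      by (rule finsum_coset) (use that x in \<open>auto simp: A_closed\<close>)
    finally have "coset (x k k) = coset (\<Sum>j<N. x k j * x j k)" .
    then have "coef \<theta> M (x k k) = coef \<theta> M (\<Sum>j<N. x k j * x j k)"
      using coset_self[of "x k k"] that x(1) by (intro coef_cong sum_closed A_closed) auto
    also have "\<dots> = (\<Sum>j<N. coef \<theta> M (x k j * nc_star (x k j)))"
      unfolding coef_sum coef_mult using that by (intro sum.cong refl) (simp add: star)
    finally show ?thesis .
  qed
  have "P $$ (k, j) \<in> {c \<odot>\<^bsub>Q\<^esub> \<one>\<^bsub>Q\<^esub> | c. True}" if "k < N" "j < N" for k j
  proof -
    have "coef \<theta> M (x k j) = 0" if "M \<noteq> {#}" for M
    proof (rule positive_row_is_constant[where J = "{..<N}" and tw = "twist \<theta>" and k = k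
          and a = "\<lambda>j M. coef \<theta> M (x k j)"])
      show "coef \<theta> L (x k k) = (\<Sum>j<N. \<Sum>K | K \<subseteq># L. twist \<theta> K (L - K) * coef \<theta> K (x k j) *
          cnj (coef \<theta> (mset_star (L - K)) (x k j)))" for L
        unfolding row[OF \<open>k < N\<close>] coef_mult_star ..
    qed (use that \<open>k < N\<close> \<open>j < N\<close> in \<open>auto simp: finite_coef_support twist_star_self\<close>)
    then have "x k j - nc_const (coef \<theta> {#} (x k j)) \<in> I"
      using that x(1) by (intro constant_mod_ideal) auto
    then have "P $$ (k, j) = coset (nc_const (coef \<theta> {#} (x k j)))"
      using that by (simp add: x coset_eq_iff const_closed)
    then show ?thesis by (auto simp: smult_one)
  qed
  then show ?thesis using dims by (auto simp: elements_mat_def)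
qed

end

theorem proposition2p3:
  fixes n :: nat and \<Theta> :: "real mat" and P :: "ncpoly set mat"
  assumes "\<Theta> \<in> carrier_mat n n"
    and "transpose_mat \<Theta> = - \<Theta>"
    and "P \<in> projectors (C_alg_odd n \<Theta>)"
  shows "P \<in> projectors (scalar_subalgebra (C_alg_odd n \<Theta>))"
proof -
  interpret theta_plane n \<Theta> using assms(1,2) by unfold_locales
  show ?thesis
    unfolding scalar_subalgebra_def
    by (rule projectors_subring[OF Q.ring_axioms subring_scalars assms(3) projector_entries_scalar[OF assms(3)]])
qed

end
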